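(* Up to isomorphism, $K_3$ is the only maximal outerplanar graph that is perfect for the stripe-game with Minimizer responding (and Maximizer initiating).
   Context: Graphs are finite, simple and undirected. $P_3$ is the path on three vertices; copies of $P_3$ in a graph are subgraphs, not necessarily induced. A maximal outerplanar graph is a graph obtained by taking a cycle (on at least three vertices) and adding pairwise noncrossing chords until no further such chord can be added (i.e. a triangulation of a polygon, with no additional vertices). The stripe-game on a graph $G$ is played by two players, Maximizer and Minimizer; throughout the game one of them is the initiator and the other is the responder. In each round, the initiator chooses a vertex $v$ of the current graph such that the current graph contains at least one copy of $P_3$ with $v$ as an end-vertex; the responder then chooses one copy of $P_3$ in the current graph with $v$ as an end-vertex; the three vertices of that copy are removed, and the next round is played on the subgraph induced by the remaining vertices. The game ends when the remaining graph contains no copy of $P_3$. Maximizer tries to maximize, and Minimizer tries to minimize, the number of copies of $P_3$ taken. The value of the game is the number of copies taken under optimal play by both players. A graph is perfect (for a given version of the game) if under optimal play all vertices are taken, i.e. the value of the game equals $|V(G)|/3$. *)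

theory Defs
  imports "Graph_Theory.Graph_Theory"
begin

text \<open>
  Finite simple undirected graphs are the symmetric digraphs of the locale \<^locale>\<open>graph\<close>,
  with adjacency \<open>u \<rightarrow>\<^bsub>G\<^esub> v\<close>, induced subgraphs \<open>G \<restriction> S\<close> and complete graphs \<open>K\<^bsub>n\<^esub> G\<close>.
\<close>

section \<open>Maximal outerplanar graphs\<close>

text \<open>The corners of an \<open>n\<close>-gon are numbered cyclically by \<open>0, \<dots>, n - 1\<close>.\<close>

definition polygon_side :: "nat \<Rightarrow> nat \<Rightarrow> nat \<Rightarrow> bool" where
  "polygon_side n i j \<longleftrightarrow> j = Suc i mod n \<or> i = Suc j mod n"

text \<open>A chord is represented once, with its smaller end first.\<close>

definition polygon_chords :: "nat \<Rightarrow> (nat \<times> nat) set" where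
  "polygon_chords n = {(i, j). i < j \<and> j < n \<and> \<not> polygon_side n i j}"

fun crossing :: "nat \<times> nat \<Rightarrow> nat \<times> nat \<Rightarrow> bool" where
  "crossing (i, j) (k, l) \<longleftrightarrow> (i < k \<and> k < j \<and> j < l) \<or> (k < i \<and> i < l \<and> l < j)"

definition noncrossing :: "(nat \<times> nat) set \<Rightarrow> bool" where
  "noncrossing D \<longleftrightarrow> (\<forall>d\<in>D. \<forall>e\<in>D. \<not> crossing d e)"

definition maximal_noncrossing :: "nat \<Rightarrow> (nat \<times> nat) set \<Rightarrow> bool" where
  "maximal_noncrossing n D \<longleftrightarrow> D \<subseteq> polygon_chords n \<and> noncrossing D \<and>
     (\<forall>d \<in> polygon_chords n - D. \<not> noncrossing (insert d D))"

definition maximal_outerplanar :: "('a, 'b) pre_digraph \<Rightarrow> bool" where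
  "maximal_outerplanar G \<longleftrightarrow> graph G \<and>
     (\<exists>n c D. 3 \<le> n \<and> bij_betw c {..<n} (verts G) \<and> maximal_noncrossing n D \<and>
       (\<forall>i<n. \<forall>j<n. c i \<rightarrow>\<^bsub>G\<^esub> c j \<longleftrightarrow> polygon_side n i j \<or> (i, j) \<in> D \<or> (j, i) \<in> D))"

section \<open>The stripe-game\<close>

datatype player = Maximizer | Minimizer

fun opponent :: "player \<Rightarrow> player" where
  "opponent Maximizer = Minimizer"
| "opponent Minimizer = Maximizer"

fun best_for :: "player \<Rightarrow> nat set \<Rightarrow> nat" where
  "best_for Maximizer X = Max X"
| "best_for Minimizer X = Min X"

text \<open>
  The copies of the path \<open>P\<^sub>3\<close> with \<open>v\<close> as an end-vertex: the pair \<open>(w, x)\<close> stands for the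
  copy with edges \<open>vw\<close> and \<open>wx\<close>. The three vertices are pairwise distinct in a loop-free graph
  as soon as \<open>v \<noteq> x\<close>.
\<close>

definition P3_from :: "('a, 'b) pre_digraph \<Rightarrow> 'a \<Rightarrow> ('a \<times> 'a) set" where
  "P3_from G v = {(w, x). v \<rightarrow>\<^bsub>G\<^esub> w \<and> w \<rightarrow>\<^bsub>G\<^esub> x \<and> v \<noteq> x}"

definition P3_ends :: "('a, 'b) pre_digraph \<Rightarrow> 'a set" where
  "P3_ends G = {v \<in> verts G. P3_from G v \<noteq> {}}"

text \<open>
  \<open>stripe_value I G\<close> is the number of copies taken from \<open>G\<close> under optimal play when \<open>I\<close> is the
  initiator throughout. The test \<^term>\<open>graph G\<close> only serves termination: induced subgraphs of
  graphs are graphs.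
\<close>

function stripe_value :: "player \<Rightarrow> ('a, 'b) pre_digraph \<Rightarrow> nat" where
  "stripe_value I G =
     (if graph G \<and> P3_ends G \<noteq> {}
      then best_for I ((\<lambda>v.
             best_for (opponent I) ((\<lambda>(w, x).
               Suc (stripe_value I (G \<restriction> (verts G - {v, w, x})))) ` P3_from G v)) ` P3_ends G)
      else 0)"
  by pat_completeness auto
termination
proof (relation "measure (\<lambda>(I, G). card (verts G))", goal_cases)
  case 1
  show ?case by simp
next
  case (2 I G v p w x)
  then interpret graph G by simp
  have "v \<in> verts G" using 2 by (simp add: P3_ends_def)
  then have "verts G - {v, w, x} \<subset> verts G" by blast
  then show ?case by (simp add: psubset_card_mono)
qed

declare stripe_value.simps [simp del]

definition stripe_perfect :: "player \<Rightarrow> ('a, 'b) pre_digraph \<Rightarrow> bool" where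
  "stripe_perfect I G \<longleftrightarrow> 3 * stripe_value I G = card (verts G)"

end

theory Submission
  imports Defs
begin

text \<open>
  Why every other maximal outerplanar graph fails to be perfect: Minimizer can spoil the game with
  the very first response. Suppose the game on \<open>G\<close> is perfect, so that \<open>n = |V(G)|\<close> is a multiple
  of three. Some first choice \<open>v\<close> of Maximizer must be good against every response, so whichever
  path \<open>v, w, x\<close> Minimizer removes, the rest is again taken completely
  (\<open>perfect_initial_vertex\<close>). The rest then splits into copies of \<open>P\<^sub>3\<close>; as each copy is connected,
  every union of components of the rest has a size divisible by three
  (\<open>stripe_perfect_dvd_card_separated\<close>).

  Number the corners of the polygon so that \<open>v = 0\<close>. An edge \<open>ij\<close> of a triangulated polygon
  separates the corners strictly between \<open>i\<close> and \<open>j\<close> from the others (\<open>edge_separates\<close>). So if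
  Minimizer removes a path \<open>0, a, b\<close>, the corners left on either side of an edge between two of
  these three must be divisible by three in number. This is impossible for \<open>n > 3\<close>
  (\<open>unbalanced_path_from_0\<close>):

  \<^item> If \<open>0\<close> has a neighbour \<open>m\<close> other than \<open>1\<close> and \<open>n - 1\<close>, there are triangles \<open>0 p m\<close> and
    \<open>0 m q\<close> on the two sides of the chord. Removing the second forces \<open>3\<close> to divide the number
    \<open>m - 1\<close> of corners cut off by the chord. Removing the first takes one of these corners, \<open>p\<close>,
    away, so \<open>3\<close> must divide \<open>m - 2\<close> as well.
  \<^item> Otherwise \<open>0\<close> has degree two, its neighbours \<open>1\<close> and \<open>n - 1\<close> are adjacent, and a triangle
    \<open>1, p, n - 1\<close> lies on the far side of that edge. The paths \<open>0, 1, p\<close> and \<open>0, n - 1, p\<close> force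
    \<open>3\<close> to divide \<open>p - 2\<close> and \<open>n - 2 - p\<close>, hence also their sum \<open>n - 4\<close>, whereas \<open>3\<close> divides \<open>n\<close>.

  For \<open>n = 3\<close> the polygon is a triangle, which the first move takes completely.
\<close>

section \<open>Perfect games and separated vertex sets\<close>

lemma dominates_induce_subgraph_iff:
  "u \<rightarrow>\<^bsub>G \<restriction> S\<^esub> v \<longleftrightarrow> u \<rightarrow>\<^bsub>G\<^esub> v \<and> u \<in> S \<and> v \<in> S"
  by (auto simp: arcs_ends_def arc_to_ends_def)

lemma (in graph) graph_induce_subgraph:
  assumes "S \<subseteq> verts G"
  shows "graph (G \<restriction> S)"
proof -
  have "induced_subgraph (G \<restriction> S) G" using assms by (rule induced_induce)
  then have "digraph (G \<restriction> S)" "symmetric (G \<restriction> S)"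
    by (auto intro: digraphI_induced induced_graph_imp_symmetric sym_arcs)
  then show ?thesis
    by (simp add: graph_def pseudo_graph_def sym_digraph_def sym_digraph_axioms_def digraph_def
        fin_digraph_def)
qed

lemma (in graph) finite_P3_from: "finite (P3_from G v)"
  by (rule finite_subset[of _ "verts G \<times> verts G"])
     (auto simp: P3_from_def adj_in_verts)

lemma (in graph) P3_from_card:
  assumes "(w, x) \<in> P3_from G v"
  shows "{v, w, x} \<subseteq> verts G" "card {v, w, x} = 3"
proof -
  have e: "v \<rightarrow> w" "w \<rightarrow> x" "v \<noteq> x" using assms by (auto simp: P3_from_def)
  then show "{v, w, x} \<subseteq> verts G" by (auto simp: adj_in_verts)
  have "v \<noteq> w" "w \<noteq> x" using e adj_not_same by blast+
  then show "card {v, w, x} = 3" using e by simp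
qed

lemma best_for_in:
  assumes "finite X" "X \<noteq> {}"
  shows "best_for I X \<in> X"
  using assms by (cases I) (auto intro: Max_in Min_in)

lemma (in graph) stripe_value_best_vertex:
  assumes "P3_ends G \<noteq> {}"
  obtains v where "v \<in> P3_ends G"
    "stripe_value I G = best_for (opponent I)
       ((\<lambda>(w, x). Suc (stripe_value I (G \<restriction> (verts G - {v, w, x})))) ` P3_from G v)"
proof -
  define g where "g v = best_for (opponent I)
    ((\<lambda>(w, x). Suc (stripe_value I (G \<restriction> (verts G - {v, w, x})))) ` P3_from G v)" for v
  have "stripe_value I G = best_for I (g ` P3_ends G)"
    using assms graph_axioms by (subst stripe_value.simps) (simp add: g_def)
  moreover have "best_for I (g ` P3_ends G) \<in> g ` P3_ends G"
    using assms by (intro best_for_in) (auto simp: P3_ends_def)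
  ultimately have "stripe_value I G \<in> g ` P3_ends G" by simp
  then show thesis using that by (auto simp: g_def)
qed

lemma (in graph) stripe_value_attained:
  assumes "P3_ends G \<noteq> {}"
  obtains v w x where "v \<in> P3_ends G" "(w, x) \<in> P3_from G v"
    "stripe_value I G = Suc (stripe_value I (G \<restriction> (verts G - {v, w, x})))"
proof -
  define f where "f v = (\<lambda>(w, x). Suc (stripe_value I (G \<restriction> (verts G - {v, w, x}))))" for v
  obtain v where v: "v \<in> P3_ends G"
    "stripe_value I G = best_for (opponent I) (f v ` P3_from G v)"
    using stripe_value_best_vertex[OF assms, of I] unfolding f_def by blast
  then have "stripe_value I G \<in> f v ` P3_from G v"
    using best_for_in[of "f v ` P3_from G v"] finite_P3_from by (auto simp: P3_ends_def)
  then show thesis using that v(1) by (auto simp: f_def)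
qed

text \<open>
  A round removes exactly three vertices. This drives every induction on the game, and it makes
  perfection of a graph equivalent to perfection of the position after an optimal round.
\<close>

lemma (in graph) card_verts_remove_P3:
  assumes "(w, x) \<in> P3_from G v"
  shows "card (verts G) = card (verts G - {v, w, x}) + 3"
proof -
  have "card (verts G - {v, w, x}) = card (verts G) - 3" "3 \<le> card (verts G)"
    using P3_from_card[OF assms] card_Diff_subset[of "{v, w, x}" "verts G"]
      card_mono[of "verts G" "{v, w, x}"] by auto
  then show ?thesis by simp
qed

lemma stripe_value_no_moves: "P3_ends G = {} \<Longrightarrow> stripe_value I G = 0"
  by (subst stripe_value.simps) simp

lemma stripe_value_le:
  assumes "graph G"
  shows "3 * stripe_value I G \<le> card (verts G)"
  using assms
proof (induction "card (verts G)" arbitrary: G rule: less_induct)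
  case less
  interpret graph G by fact
  show ?case
  proof (cases "P3_ends G = {}")
    case True
    then show ?thesis by (simp add: stripe_value_no_moves)
  next
    case False
    then obtain v w x where *: "(w, x) \<in> P3_from G v"
      "stripe_value I G = Suc (stripe_value I (G \<restriction> (verts G - {v, w, x})))"
      by (elim stripe_value_attained)
    have "3 * stripe_value I (G \<restriction> (verts G - {v, w, x})) \<le> card (verts G - {v, w, x})"
      using less(1)[of "G \<restriction> (verts G - {v, w, x})"] card_verts_remove_P3[OF *(1)]
      by (simp add: graph_induce_subgraph)
    then show ?thesis using * card_verts_remove_P3[OF *(1)] by simp
  qed
qed

lemma stripe_perfect_moves:
  assumes "graph G" "stripe_perfect I G" "verts G \<noteq> {}"
  shows "P3_ends G \<noteq> {}"
proof -
  interpret graph G by fact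
  show ?thesis
    using assms stripe_value_no_moves[of G I] finite_verts by (auto simp: stripe_perfect_def)
qed

text \<open>
  A play in which all vertices are taken partitions the graph into copies of \<open>P\<^sub>3\<close>. As these are
  connected, a set that no edge leaves consists of whole copies. The induction follows one optimal
  play and peels off these copies one by one.
\<close>

lemma stripe_perfect_dvd_card_separated:
  assumes "graph G" "stripe_perfect I G" "S \<subseteq> verts G"
    and "\<And>s t. s \<in> S \<Longrightarrow> s \<rightarrow>\<^bsub>G\<^esub> t \<Longrightarrow> t \<in> S"
  shows "3 dvd card S"
  using assms
proof (induction "card (verts G)" arbitrary: G S rule: less_induct)
  case less
  interpret graph G by fact
  show ?case
  proof (cases "verts G = {}")
    case True
    then show ?thesis using less.prems by simp
  next
    case False
    then have "P3_ends G \<noteq> {}" using less.prems stripe_perfect_moves by blast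
    then obtain v w x where *: "(w, x) \<in> P3_from G v"
      "stripe_value I G = Suc (stripe_value I (G \<restriction> (verts G - {v, w, x})))"
      by (elim stripe_value_attained)
    define R where "R = {v, w, x}"
    have R: "R \<subseteq> verts G" "card R = 3" "finite R"
      using P3_from_card[OF *(1)] by (auto simp: R_def)
    have "3 dvd card (S - R)"
    proof (rule less.hyps[of "G \<restriction> (verts G - R)"])
      show "card (verts (G \<restriction> (verts G - R))) < card (verts G)"
        using card_verts_remove_P3[OF *(1)] by (simp add: R_def)
      show "graph (G \<restriction> (verts G - R))" by (simp add: graph_induce_subgraph)
      show "stripe_perfect I (G \<restriction> (verts G - R))"
        using less.prems(2) * card_verts_remove_P3[OF *(1)]
        by (simp add: stripe_perfect_def R_def)
      show "S - R \<subseteq> verts (G \<restriction> (verts G - R))" using less.prems by auto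
      show "\<And>s t. s \<in> S - R \<Longrightarrow> s \<rightarrow>\<^bsub>G \<restriction> (verts G - R)\<^esub> t \<Longrightarrow> t \<in> S - R"
        using less.prems(4) by (auto simp: dominates_induce_subgraph_iff)
    qed
    moreover
    \<comment> \<open>The removed path is connected, so it lies on one side of the separation.\<close>
    have "v \<rightarrow>\<^bsub>G\<^esub> w" "w \<rightarrow>\<^bsub>G\<^esub> v" "w \<rightarrow>\<^bsub>G\<^esub> x" "x \<rightarrow>\<^bsub>G\<^esub> w"
      using *(1) by (auto simp: P3_from_def intro: graph_symmetric)
    then have "R \<subseteq> S \<or> R \<inter> S = {}"
      unfolding R_def using less.prems(4) by blast
    then have "card S = card (S - R) \<or> card S = card (S - R) + 3"
    proof
      assume "R \<subseteq> S"
      then show ?thesis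
        using R card_Diff_subset[of R S] card_mono[of S R] less.prems(3) finite_verts
          finite_subset by fastforce
    next
      assume "R \<inter> S = {}"
      then have "S - R = S" by blast
      then show ?thesis by simp
    qed
    ultimately show ?thesis by auto
  qed
qed

text \<open>
  In a perfect game no response to an optimal choice of Maximizer can leave a position that is not
  perfect: the minimum over the responses already attains the bound of \<open>stripe_value_le\<close>.
\<close>

lemma perfect_initial_vertex:
  assumes "graph G" "stripe_perfect Maximizer G" "verts G \<noteq> {}"
  obtains v where "v \<in> verts G"
    "\<And>w x. (w, x) \<in> P3_from G v \<Longrightarrow> stripe_perfect Maximizer (G \<restriction> (verts G - {v, w, x}))"
proof -
  interpret graph G by fact
  define f where
    "f v = (\<lambda>(w, x). Suc (stripe_value Maximizer (G \<restriction> (verts G - {v, w, x}))))" for v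
  have "P3_ends G \<noteq> {}" using assms by (rule stripe_perfect_moves)
  then obtain v where v: "v \<in> P3_ends G"
    "stripe_value Maximizer G = Min (f v ` P3_from G v)"
    using stripe_value_best_vertex[of Maximizer] unfolding f_def by auto
  have "stripe_perfect Maximizer (G \<restriction> (verts G - {v, w, x}))" if m: "(w, x) \<in> P3_from G v" for w x
  proof -
    have "Min (f v ` P3_from G v) \<le> f v (w, x)"
      using m finite_P3_from by (intro Min_le) auto
    then have "card (verts G) \<le> 3 * Suc (stripe_value Maximizer (G \<restriction> (verts G - {v, w, x})))"
      using v assms(2) by (auto simp: stripe_perfect_def f_def)
    moreover have "3 * stripe_value Maximizer (G \<restriction> (verts G - {v, w, x}))
        \<le> card (verts G - {v, w, x})"
      using stripe_value_le[of "G \<restriction> (verts G - {v, w, x})"] by (simp add: graph_induce_subgraph)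
    ultimately show ?thesis
      using card_verts_remove_P3[OF m] by (simp add: stripe_perfect_def)
  qed
  moreover have "v \<in> verts G" using v by (simp add: P3_ends_def)
  ultimately show thesis using that by blast
qed

section \<open>Triangulated polygons\<close>

text \<open>
  The relation \<open>E\<close> comprises the sides of the polygon and the chords of a triangulation. Having one
  symmetric relation, instead of a set of ordered chords beside the sides, is what makes the axioms
  invariant under renumbering the corners cyclically. Maximality is the axiom \<open>crossed\<close>: a missing
  pair is crossed by some edge.
\<close>

locale polygon_triangulation =
  fixes n :: nat and E :: "nat \<Rightarrow> nat \<Rightarrow> bool"
  assumes three_le: "3 \<le> n"
    and bounded: "E i j \<Longrightarrow> i < n \<and> j < n \<and> i \<noteq> j"
    and sym: "E i j \<Longrightarrow> E j i"
    and side: "i < n \<Longrightarrow> E i (Suc i mod n)"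
    and no_crossing: "E i j \<Longrightarrow> E k l \<Longrightarrow> \<not> (i < k \<and> k < j \<and> j < l)"
    and crossed: "i < j \<Longrightarrow> j < n \<Longrightarrow> \<not> E i j \<Longrightarrow>
      \<exists>k l. E k l \<and> i < k \<and> k < j \<and> (l < i \<or> j < l)"
begin

lemma side_Suc: "Suc i < n \<Longrightarrow> E i (Suc i)"
  using side[of i] by simp

lemma side_last: "E 0 (n - 1)"
  using side[of "n - 1"] sym three_le by (cases n) auto

lemma edge_separates:
  assumes "E i j" "E s t" "i < s" "s < j"
  shows "i \<le> t \<and> t \<le> j"
  using assms no_crossing[of i j s t] no_crossing[of t s i j] sym[of s t] by auto

text \<open>
  The third corner is the neighbour \<open>k\<close> of \<open>i\<close> nearest to \<open>j\<close>. If \<open>k\<close> and \<open>j\<close> were not adjacent, an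
  edge would cross the pair; caught between the edges \<open>ij\<close> and \<open>ik\<close>, it could only end in \<open>i\<close>, and
  then \<open>i\<close> would have a nearer neighbour.
\<close>

lemma triangle_inside:
  assumes "E i j" "Suc i < j"
  obtains k where "i < k" "k < j" "E i k" "E k j"
proof -
  define k where "k = Max {k. E i k \<and> i < k \<and> k < j}"
  have fin: "finite {k. E i k \<and> i < k \<and> k < j}"
    by (rule finite_subset[of _ "{..<j}"]) auto
  have "E i (Suc i)" using assms bounded[of i j] by (intro side_Suc) auto
  then have "k \<in> {k. E i k \<and> i < k \<and> k < j}"
    unfolding k_def using assms fin by (intro Max_in) auto
  then have k: "E i k" "i < k" "k < j" by auto
  have max: "s \<le> k" if "E i s" "i < s" "s < j" for s
    unfolding k_def using fin that by (intro Max_ge) auto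
  have "E k j"
  proof (rule ccontr)
    assume "\<not> E k j"
    then obtain s t where st: "E s t" "k < s" "s < j" "t < k \<or> j < t"
      using crossed[of k j] k assms bounded by blast
    have "i \<le> t" "t \<le> j" using edge_separates[OF assms(1) st(1)] st k by auto
    moreover have "\<not> (i < t \<and> t < k)" using no_crossing[of i k t s] k st sym by blast
    ultimately have "t = i" using st by auto
    then show False using max[of s] st k sym by auto
  qed
  then show thesis using that k by blast
qed

text \<open>
  The triangle on the other side of the edge \<open>0m\<close>, found in the same way: consecutive neighbours
  of a corner are adjacent.
\<close>

lemma next_neighbour_of_0:
  assumes "E 0 m" "m < n - 1"
  obtains q where "m < q" "E 0 q" "E m q"
proof -
  define q where "q = (LEAST q. E 0 q \<and> m < q)"
  have q: "E 0 q" "m < q"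
    using LeastI[of "\<lambda>q. E 0 q \<and> m < q" "n - 1"] assms side_last by (auto simp: q_def)
  have least: "q \<le> s" if "E 0 s" "m < s" for s
    unfolding q_def using that by (intro Least_le) auto
  have m0: "0 < m" using bounded[OF assms(1)] by auto
  have "E m q"
  proof (rule ccontr)
    assume "\<not> E m q"
    then obtain s t where st: "E s t" "m < s" "s < q" "t < m \<or> q < t"
      using crossed[of m q] q bounded by blast
    have "t \<le> q" using edge_separates[OF q(1) st(1)] st m0 by auto
    moreover have "\<not> (0 < t \<and> t < m)" using no_crossing[of 0 m t s] assms st sym by blast
    ultimately have "t = 0" using st by auto
    then show False using least[of s] st sym by force
  qed
  then show thesis using that q by blast
qed

text \<open>
  The path \<open>0, a, b\<close> is Minimizer's spoiling response to the choice of corner \<open>0\<close>. The edge \<open>ij\<close>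
  joins two removed corners, so what is left between \<open>i\<close> and \<open>j\<close> is cut off from the rest.
\<close>

lemma unbalanced_path_from_0:
  assumes "n \<noteq> 3" "3 dvd n"
  obtains a b i j where "E 0 a" "E a b" "b \<noteq> 0" "E i j" "{i, j} \<subseteq> {0, a, b}" "i < j"
    "\<not> 3 dvd card ({i<..<j} - {0, a, b})"
proof -
  have n6: "6 \<le> n" using assms three_le by presburger
  show thesis
  proof (cases "\<exists>m. E 0 m \<and> 1 < m \<and> m < n - 1")
    case True
    then obtain m where m: "E 0 m" "1 < m" "m < n - 1" by blast
    obtain p where p: "0 < p" "p < m" "E 0 p" "E p m"
      using triangle_inside[of 0 m] m by auto
    obtain q where q: "m < q" "E 0 q" "E m q" using next_neighbour_of_0[of m] m by auto
    have "{0<..<m} - {0, m, q} = {0<..<m}" using q by auto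
    then have c1: "card ({0<..<m} - {0, m, q}) = m - 1" by simp
    have "{0<..<m} - {0, p, m} = {0<..<m} - {p}" by auto
    then have c2: "card ({0<..<m} - {0, p, m}) = m - 2" using p by simp
    have "\<not> (3 dvd m - 1 \<and> 3 dvd m - 2)" using m by presburger
    then consider "\<not> 3 dvd m - 1" | "\<not> 3 dvd m - 2" by blast
    then show thesis
    proof cases
      case 1
      then show thesis using that[of m q 0 m] c1 m q by auto
    next
      case 2
      then show thesis using that[of p m 0 m] c2 m p by auto
    qed
  next
    case False
    have e1: "E 0 1" using side_Suc[of 0] n6 by auto
    have en: "E 0 (n - 1)" by (rule side_last)
    have "1 < n - 1" using n6 by simp
    then obtain q where q: "1 < q" "E 0 q" "E 1 q" using next_neighbour_of_0[OF e1] by blast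
    then have "q = n - 1" using False bounded[OF q(2)] by force
    then have e1n: "E 1 (n - 1)" using q by simp
    have "Suc 1 < n - 1" using n6 by simp
    then obtain p where p: "1 < p" "p < n - 1" "E 1 p" "E p (n - 1)"
      using triangle_inside[OF e1n] by blast
    have "{1<..<p} - {0, 1, p} = {1<..<p}" by auto
    then have c1: "card ({1<..<p} - {0, 1, p}) = p - 2" by simp
    have "{p<..<n - 1} - {0, n - 1, p} = {p<..<n - 1}" by auto
    then have c2: "card ({p<..<n - 1} - {0, n - 1, p}) = n - 2 - p" by simp
    have "\<not> (3 dvd p - 2 \<and> 3 dvd n - 2 - p)"
    proof
      assume "3 dvd p - 2 \<and> 3 dvd n - 2 - p"
      then have "3 dvd (p - 2) + (n - 2 - p)" by (intro dvd_add) auto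
      also have "(p - 2) + (n - 2 - p) = n - 4" using p by simp
      finally have "3 dvd n - (n - 4)" by (rule dvd_diff_nat[OF assms(2)])
      also have "n - (n - 4) = 4" using n6 by simp
      finally show False by simp
    qed
    then consider "\<not> 3 dvd p - 2" | "\<not> 3 dvd n - 2 - p" by blast
    then show thesis
    proof cases
      case 1
      then show thesis using that[of 1 p 1 p] c1 e1 p by auto
    next
      case 2
      then show thesis using that[of "n - 1" p p "n - 1"] c2 en p sym by auto
    qed
  qed
qed

text \<open>
  Under a shift of the numbering by one only a pair containing the last corner changes its order.
  This is where the proof has to distinguish cases.
\<close>

lemma rotate: "polygon_triangulation n (\<lambda>i j. i < n \<and> j < n \<and> E (Suc i mod n) (Suc j mod n))"
  (is "polygon_triangulation n ?F")
proof
  show "3 \<le> n" by (rule three_le)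
  fix i j k l
  show "?F i j \<Longrightarrow> i < n \<and> j < n \<and> i \<noteq> j" using bounded by blast
  show "?F i j \<Longrightarrow> ?F j i" using sym by blast
  show "i < n \<Longrightarrow> ?F i (Suc i mod n)" using side[of "Suc i mod n"] by simp
  show "\<not> (i < k \<and> k < j \<and> j < l)" if "?F i j" "?F k l"
  proof
    assume o: "i < k \<and> k < j \<and> j < l"
    show False
    proof (cases "Suc l < n")
      case True
      then show False using that o no_crossing[of "Suc i" "Suc j" "Suc k" "Suc l"] by simp
    next
      case False
      then have "Suc l = n" using that by simp
      then show False using that o no_crossing[of 0 "Suc k" "Suc i" "Suc j"] sym by auto
    qed
  qed
  show "\<exists>k l. ?F k l \<and> i < k \<and> k < j \<and> (l < i \<or> j < l)"
    if ij: "i < j" "j < n" "\<not> ?F i j"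
  proof (cases "Suc j < n")
    case True
    then obtain k l where kl: "E k l" "Suc i < k" "k < Suc j" "l < Suc i \<or> Suc j < l"
      using ij crossed[of "Suc i" "Suc j"] by auto
    then have b: "k < n" "l < n" using bounded by auto
    \<comment> \<open>The corner 0 is the image of the last corner.\<close>
    define l' where "l' = (if l = 0 then n - 1 else l - 1)"
    have "Suc l' mod n = l" "l' < n" "l' < i \<or> j < l'"
      using b kl True by (auto simp: l'_def split: if_splits)
    then show ?thesis using kl b by (intro exI[of _ "k - 1"] exI[of _ l']) auto
  next
    case False
    then have j: "Suc j = n" using ij by simp
    then have "\<not> E 0 (Suc i)" using ij sym by auto
    then obtain k l where kl: "E k l" "0 < k" "k < Suc i" "Suc i < l"
      using ij crossed[of 0 "Suc i"] by auto
    then have "k < n" "l < n" using bounded by auto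
    then show ?thesis using kl j sym by (intro exI[of _ "l - 1"] exI[of _ "k - 1"]) auto
  qed
qed

end

section \<open>Perfect maximal outerplanar graphs\<close>

lemma maximal_noncrossing_triangulation:
  assumes "3 \<le> n" "maximal_noncrossing n D"
  shows "polygon_triangulation n
    (\<lambda>i j. i < n \<and> j < n \<and> (polygon_side n i j \<or> (i, j) \<in> D \<or> (j, i) \<in> D))"
    (is "polygon_triangulation n ?E")
proof
  have D: "D \<subseteq> polygon_chords n" "noncrossing D"
    "\<And>d. d \<in> polygon_chords n - D \<Longrightarrow> \<not> noncrossing (insert d D)"
    using assms(2) by (auto simp: maximal_noncrossing_def)
  have D_lt: "i < j \<and> j < n" if "(i, j) \<in> D" for i j
    using D(1) that by (auto simp: polygon_chords_def)
  have E_lt: "?E i j \<longleftrightarrow> j < n \<and> (j = Suc i \<or> i = 0 \<and> j = n - 1 \<or> (i, j) \<in> D)" if "i < j" for i j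
    using that assms(1) D_lt[of j i] mod_less[of "Suc i" n] mod_less[of "Suc j" n]
    by (cases "Suc j = n") (auto simp: polygon_side_def)
  show "3 \<le> n" by fact
  fix i j k l
  show "?E i j \<Longrightarrow> i < n \<and> j < n \<and> i \<noteq> j"
    using assms(1) D_lt by (cases "Suc i = n") (auto simp: polygon_side_def)
  show "?E i j \<Longrightarrow> ?E j i" by (auto simp: polygon_side_def)
  show "i < n \<Longrightarrow> ?E i (Suc i mod n)" by (auto simp: polygon_side_def)
  show "\<not> (i < k \<and> k < j \<and> j < l)" if "?E i j" "?E k l"
  proof
    assume o: "i < k \<and> k < j \<and> j < l"
    then have "(i, j) \<in> D" "(k, l) \<in> D" using that E_lt[of i j] E_lt[of k l] by auto
    then have "\<not> crossing (i, j) (k, l)" using D(2) unfolding noncrossing_def by blast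
    then show False using o by simp
  qed
  show "\<exists>k l. ?E k l \<and> i < k \<and> k < j \<and> (l < i \<or> j < l)"
    if ij: "i < j" "j < n" "\<not> ?E i j"
  proof -
    have "(i, j) \<in> polygon_chords n - D" using ij by (auto simp: polygon_chords_def)
    then have "\<not> noncrossing (insert (i, j) D)" by (rule D(3))
    then obtain k l where kl: "(k, l) \<in> D" "crossing (i, j) (k, l) \<or> crossing (k, l) (i, j)"
      using D(2) unfolding noncrossing_def by auto
    then have "i < k \<and> k < j \<and> j < l \<or> k < i \<and> i < l \<and> l < j" by auto
    then show ?thesis using kl(1) D_lt[OF kl(1)] by (metis order.strict_trans)
  qed
qed

text \<open>
  This form of outerplanarity, without a distinguished chord set, passes to rotated numberings.
  The bounds on \<open>i\<close> and \<open>j\<close> are needed because \<open>c\<close> is arbitrary beyond \<open>n\<close>.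
\<close>

definition outer_labelling :: "('a, 'b) pre_digraph \<Rightarrow> nat \<Rightarrow> (nat \<Rightarrow> 'a) \<Rightarrow> bool" where
  "outer_labelling G n c \<longleftrightarrow> bij_betw c {..<n} (verts G) \<and>
     polygon_triangulation n (\<lambda>i j. i < n \<and> j < n \<and> c i \<rightarrow>\<^bsub>G\<^esub> c j)"

lemma maximal_outerplanar_labelling:
  assumes "maximal_outerplanar G"
  obtains n c where "outer_labelling G n c"
proof -
  obtain n c D where *: "3 \<le> n" "bij_betw c {..<n} (verts G)" "maximal_noncrossing n D"
    "\<forall>i<n. \<forall>j<n. c i \<rightarrow>\<^bsub>G\<^esub> c j \<longleftrightarrow> polygon_side n i j \<or> (i, j) \<in> D \<or> (j, i) \<in> D"
    using assms by (auto simp: maximal_outerplanar_def)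
  have "(\<lambda>i j. i < n \<and> j < n \<and> c i \<rightarrow>\<^bsub>G\<^esub> c j) =
     (\<lambda>i j. i < n \<and> j < n \<and> (polygon_side n i j \<or> (i, j) \<in> D \<or> (j, i) \<in> D))"
    using *(4) by (intro ext) auto
  then have "outer_labelling G n c"
    using * maximal_noncrossing_triangulation[OF *(1,3)] by (simp add: outer_labelling_def)
  then show thesis by (rule that)
qed

lemma bij_betw_Suc_mod: "bij_betw (\<lambda>i. Suc i mod n) {..<n} {..<n}"
proof (cases n)
  case (Suc m)
  show ?thesis
  proof (rule bij_betw_byWitness[where f' = "\<lambda>i. if i = 0 then m else i - 1"])
    show "\<forall>i\<in>{..<n}. (if Suc i mod n = 0 then m else Suc i mod n - 1) = i"
      using Suc by (auto simp: mod_Suc)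
  qed (use Suc in auto)
qed simp

lemma outer_labelling_rotate:
  assumes "outer_labelling G n c"
  shows "outer_labelling G n (\<lambda>i. c (Suc i mod n))"
proof -
  interpret polygon_triangulation n "\<lambda>i j. i < n \<and> j < n \<and> c i \<rightarrow>\<^bsub>G\<^esub> c j"
    using assms by (simp add: outer_labelling_def)
  have "(\<lambda>i j. i < n \<and> j < n \<and> Suc i mod n < n \<and> Suc j mod n < n
      \<and> c (Suc i mod n) \<rightarrow>\<^bsub>G\<^esub> c (Suc j mod n)) =
      (\<lambda>i j. i < n \<and> j < n \<and> c (Suc i mod n) \<rightarrow>\<^bsub>G\<^esub> c (Suc j mod n))"
    by (intro ext) auto
  then show ?thesis
    using assms rotate bij_betw_trans[OF bij_betw_Suc_mod, of c n "verts G"]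
    by (simp add: outer_labelling_def comp_def)
qed

text \<open>
  By rotation any chosen vertex may be corner \<open>0\<close>, so only first moves at corner \<open>0\<close> have to be
  studied.
\<close>

lemma outer_labelling_from:
  assumes "outer_labelling G n c" "v \<in> verts G"
  obtains c' where "outer_labelling G n c'" "c' 0 = v"
proof -
  have *: "\<exists>c'. outer_labelling G n c' \<and> c' 0 = c k" if "outer_labelling G n c" "k < n" for k c
    using that
  proof (induction k arbitrary: c)
    case (Suc k)
    then show ?case using Suc.IH[OF outer_labelling_rotate] by fastforce
  qed blast
  have "v \<in> c ` {..<n}" using assms by (auto simp: outer_labelling_def bij_betw_def)
  then obtain k where "k < n" "v = c k" by blast
  then show thesis using * assms(1) that by metis
qed

text \<open>
  Here \<open>R\<close> is the spoiling path of \<open>unbalanced_path_from_0\<close>, starting in Maximizer's best vertex,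
  and \<open>T\<close> the set of corners that it cuts off, which is separated after the removal of \<open>R\<close> although
  its size is not divisible by three.
\<close>

lemma maximal_outerplanar_perfect_card:
  assumes "maximal_outerplanar G" "stripe_perfect Maximizer G"
  shows "card (verts G) = 3"
proof (rule ccontr)
  assume n3: "card (verts G) \<noteq> 3"
  interpret graph G using assms by (simp add: maximal_outerplanar_def)
  obtain n c0 where c0: "outer_labelling G n c0"
    using assms(1) by (rule maximal_outerplanar_labelling)
  then have "bij_betw c0 {..<n} (verts G)" by (simp add: outer_labelling_def)
  from bij_betw_same_card[OF this] have n: "card (verts G) = n" by simp
  have "3 \<le> n"
    using c0 polygon_triangulation.three_le unfolding outer_labelling_def by blast
  then have "verts G \<noteq> {}" using n by auto
  then obtain v where v: "v \<in> verts G"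
    "\<And>w x. (w, x) \<in> P3_from G v \<Longrightarrow> stripe_perfect Maximizer (G \<restriction> (verts G - {v, w, x}))"
    using perfect_initial_vertex[OF graph_axioms assms(2)] by blast
  obtain c where c: "outer_labelling G n c" "c 0 = v"
    using outer_labelling_from[OF c0 v(1)] by blast
  define E where "E i j \<longleftrightarrow> i < n \<and> j < n \<and> c i \<rightarrow>\<^bsub>G\<^esub> c j" for i j
  interpret polygon_triangulation n E
    using c by (simp add: outer_labelling_def E_def[abs_def])
  have bij: "bij_betw c {..<n} (verts G)" using c by (simp add: outer_labelling_def)
  then have inj: "inj_on c {..<n}" by (rule bij_betw_imp_inj_on)
  have "3 dvd n" using assms(2) n by (metis dvd_triv_left stripe_perfect_def)
  then obtain a b i j where r: "E 0 a" "E a b" "b \<noteq> 0" "E i j" "{i, j} \<subseteq> {0, a, b}" "i < j"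
    "\<not> 3 dvd card ({i<..<j} - {0, a, b})"
    using n3 n unbalanced_path_from_0 by metis
  have lt: "0 < n" "a < n" "b < n" "j < n" using bounded r(1,2,4) by auto
  define R where "R = {c 0, c a, c b}"
  define T where "T = {i<..<j} - {0, a, b}"
  have "c 0 \<noteq> c b" using inj_onD[OF inj, of 0 b] r lt by auto
  then have "(c a, c b) \<in> P3_from G v"
    using r c(2) by (auto simp: P3_from_def E_def)
  then have perf: "stripe_perfect Maximizer (G \<restriction> (verts G - R))"
    using v(2) c(2) by (simp add: R_def)
  have R_iff: "c s \<in> R \<longleftrightarrow> s \<in> {0, a, b}" if "s < n" for s
    using inj_onD[OF inj] that lt by (auto simp: R_def)
  have T_lt: "T \<subseteq> {..<n}" using lt by (auto simp: T_def)
  have "3 dvd card (c ` T)"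
  proof (rule stripe_perfect_dvd_card_separated[OF _ perf])
    show "graph (G \<restriction> (verts G - R))" by (simp add: graph_induce_subgraph)
    show "c ` T \<subseteq> verts (G \<restriction> (verts G - R))"
    proof -
      have "c s \<in> verts G - R" if "s \<in> T" for s
      proof -
        have "s < n" using that T_lt by auto
        then show ?thesis
          using that R_iff[of s] bij_betw_apply[OF bij, of s] by (auto simp: T_def)
      qed
      then show ?thesis by auto
    qed
    fix x y assume x: "x \<in> c ` T" and "x \<rightarrow>\<^bsub>G \<restriction> (verts G - R)\<^esub> y"
    then have y: "x \<rightarrow>\<^bsub>G\<^esub> y" "y \<in> verts G" "y \<notin> R"
      by (auto simp: dominates_induce_subgraph_iff)
    obtain s where s: "s \<in> T" "x = c s" using x by blast
    obtain t where t: "t < n" "y = c t" using y(2) bij by (auto simp: bij_betw_def)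
    have "E s t" using s t y T_lt by (auto simp: E_def)
    then have "i \<le> t \<and> t \<le> j" using edge_separates[OF r(4)] s by (auto simp: T_def)
    moreover have "t \<notin> {0, a, b}" using R_iff[OF t(1)] t y by simp
    ultimately have "t \<in> T" using r(5) by (auto simp: T_def order.order_iff_strict)
    then show "y \<in> c ` T" using t by blast
  qed
  moreover have "card (c ` T) = card T"
    using inj T_lt by (intro card_image) (rule inj_on_subset)
  ultimately show False using r(7) by (simp add: T_def)
qed

section \<open>The triangle\<close>

lemma polygon_side_triangle:
  assumes "i < 3" "j < 3"
  shows "polygon_side 3 i j \<longleftrightarrow> i \<noteq> j"
proof -
  have "i = 0 \<or> i = 1 \<or> i = 2" "j = 0 \<or> j = 1 \<or> j = 2" using assms by arith+
  then show ?thesis by (elim disjE) (simp_all add: polygon_side_def)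
qed

lemma maximal_noncrossing_triangle: "maximal_noncrossing 3 {}"
proof -
  have "polygon_chords 3 = {}" using polygon_side_triangle by (force simp: polygon_chords_def)
  then show ?thesis by (simp add: maximal_noncrossing_def noncrossing_def)
qed

lemma maximal_outerplanar_card_3:
  assumes "maximal_outerplanar G" "card (verts G) = 3"
  shows "K\<^bsub>3\<^esub> G"
proof -
  interpret graph G using assms by (simp add: maximal_outerplanar_def)
  obtain n c D where *: "bij_betw c {..<n} (verts G)" "maximal_noncrossing n D"
    "\<forall>i<n. \<forall>j<n. c i \<rightarrow>\<^bsub>G\<^esub> c j \<longleftrightarrow> polygon_side n i j \<or> (i, j) \<in> D \<or> (j, i) \<in> D"
    using assms by (auto simp: maximal_outerplanar_def)
  have n: "n = 3" using bij_betw_same_card[OF *(1)] assms(2) by simp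
  have "u \<rightarrow>\<^bsub>G\<^esub> v" if uv: "u \<in> verts G" "v \<in> verts G" "u \<noteq> v" for u v
  proof -
    obtain i j where "u = c i" "v = c j" "i < 3" "j < 3"
      using uv(1,2) bij_betw_imp_surj_on[OF *(1), symmetric] n by (auto simp: image_iff)
    then show ?thesis using uv *(3) n polygon_side_triangle[of i j] by auto
  qed
  moreover have "u \<in> verts G \<and> v \<in> verts G \<and> u \<noteq> v" if "u \<rightarrow>\<^bsub>G\<^esub> v" for u v
    using adj_in_verts[OF that] adj_not_same[of u] that by blast
  ultimately have "arcs_ends G = {(u, v). (u, v) \<in> verts G \<times> verts G \<and> u \<noteq> v}" by blast
  then show ?thesis using assms(2) graph_axioms by (simp add: complete_digraph_def)
qed

lemma complete_digraph_3_maximal_outerplanar: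
  assumes "K\<^bsub>3\<^esub> G"
  shows "maximal_outerplanar G"
proof -
  have G: "graph G" "card (verts G) = 3"
    "arcs_ends G = {(u, v). (u, v) \<in> verts G \<times> verts G \<and> u \<noteq> v}"
    using assms by (auto simp: complete_digraph_def)
  then interpret graph G by simp
  obtain c where c: "bij_betw c {..<3::nat} (verts G)"
    using ex_bij_betw_nat_finite[OF finite_verts] G(2) by (auto simp: atLeast0LessThan)
  have "c i \<rightarrow>\<^bsub>G\<^esub> c j \<longleftrightarrow> polygon_side 3 i j \<or> (i, j) \<in> {} \<or> (j, i) \<in> {}"
    if "i < 3" "j < 3" for i j
    using that c bij_betw_apply[OF c] inj_onD[OF bij_betw_imp_inj_on[OF c], of i j]
    by (auto simp: polygon_side_triangle G(3))
  then show ?thesis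
    unfolding maximal_outerplanar_def using G(1) c maximal_noncrossing_triangle by blast
qed

lemma complete_digraph_3_perfect:
  assumes "K\<^bsub>3\<^esub> G"
  shows "stripe_perfect I G"
proof -
  have G: "graph G" "card (verts G) = 3"
    "arcs_ends G = {(u, v). (u, v) \<in> verts G \<times> verts G \<and> u \<noteq> v}"
    using assms by (auto simp: complete_digraph_def)
  then interpret graph G by simp
  obtain u v w where uvw: "verts G = {u, v, w}" "u \<noteq> v" "v \<noteq> w" "u \<noteq> w"
    using G(2) by (auto simp: card_3_iff)
  then have "(v, w) \<in> P3_from G u" by (auto simp: P3_from_def G(3))
  then have "P3_ends G \<noteq> {}" using uvw by (auto simp: P3_ends_def)
  then obtain k where "stripe_value I G = Suc k" using stripe_value_attained by metis
  then show ?thesis using stripe_value_le[OF G(1), of I] G(2) by (simp add: stripe_perfect_def)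
qed

theorem lemma12:
  fixes G :: "('a, 'b) pre_digraph"
  shows "maximal_outerplanar G \<and> stripe_perfect Maximizer G \<longleftrightarrow> K\<^bsub>3\<^esub> G"
  using maximal_outerplanar_perfect_card maximal_outerplanar_card_3
    complete_digraph_3_maximal_outerplanar complete_digraph_3_perfect by blast

end
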